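(* Suppose $\liminf \rho_{ij}=\delta>0$. Then, for any $\alpha \in (0,1)$, $$\lim_{n \to \infty}FWER(n,\alpha,\mathbf{\Sigma}_{n}) = 0.$$
   Context: Let $\Phi$ denote the cumulative distribution function of the standard normal distribution. Consider a sequence $X_1,X_2,\ldots$ of jointly normal random variables with $X_i\sim\mathcal{N}(\mu_i,1)$ and $\operatorname{Corr}(X_i,X_j)=\rho_{ij}$ for $i\neq j$, where $\rho_{ij}\in(0,1]$. Let $\mathbf{\Sigma}_n$ be the correlation matrix of $(X_1,\ldots,X_n)$. Here $\liminf\rho_{ij}$ means the limit inferior over $i\ne j$ as $i,j\to\infty$, i.e. $\lim_{N\to\infty}\inf\{\rho_{ij}: i,j\ge N,\ i\neq j\}$. The null hypotheses are $H_{0i}:\mu_i=0$, and for each $n$ the global null is $H_0=\bigcap_{i=1}^n H_{0i}$, under which $(X_1,\ldots,X_n)\sim N_n(\mathbf{0},\mathbf{\Sigma}_n)$ (possibly degenerate). For $\alpha\in(0,1)$ the one-sided Bonferroni method rejects $H_{0i}$ if $X_i>\Phi^{-1}(1-\alpha/n)$. Its familywise error rate is $$FWER(n,\alpha,\mathbf{\Sigma}_n)=\mathbb{P}_{H_0}\Big(\bigcup_{i=1}^n\{X_i>\Phi^{-1}(1-\alpha/n)\}\Big).$$ *)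

theory Defs
  imports "HOL-Probability.Probability"
begin

abbreviation std_normal_cdf :: "real \<Rightarrow> real" where
  "std_normal_cdf \<equiv> cdf std_normal_distribution"

text \<open>Only used at arguments in (0,1), where the inverse of the strictly increasing normal cdf
  is unique.\<close>

definition std_normal_quantile :: "real \<Rightarrow> real" where
  "std_normal_quantile = inv std_normal_cdf"

definition covariance :: "'a measure \<Rightarrow> ('a \<Rightarrow> real) \<Rightarrow> ('a \<Rightarrow> real) \<Rightarrow> real" where
  "covariance M X Y =
     (\<integral>\<omega>. (X \<omega> - integral\<^sup>L M X) * (Y \<omega> - integral\<^sup>L M Y) \<partial>M)"

definition correlation :: "'a measure \<Rightarrow> ('a \<Rightarrow> real) \<Rightarrow> ('a \<Rightarrow> real) \<Rightarrow> real" where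
  "correlation M X Y = covariance M X Y / sqrt (covariance M X X * covariance M Y Y)"

text \<open>Joint normality, degenerate laws included: each finite linear combination is normal, where
  an almost surely constant variable counts as normal with variance 0.\<close>

definition normal_or_const :: "'a measure \<Rightarrow> ('a \<Rightarrow> real) \<Rightarrow> bool" where
  "normal_or_const M Y \<longleftrightarrow>
     (\<exists>m s. 0 < s \<and> distributed M lborel Y (normal_density m s)) \<or>
     (\<exists>m. Y \<in> borel_measurable M \<and> (AE \<omega> in M. Y \<omega> = m))"

definition jointly_normal :: "'a measure \<Rightarrow> 'i set \<Rightarrow> ('i \<Rightarrow> 'a \<Rightarrow> real) \<Rightarrow> bool" where
  "jointly_normal M I X \<longleftrightarrow>
     (\<forall>i\<in>I. X i \<in> borel_measurable M) \<and>
     (\<forall>J c. finite J \<longrightarrow> J \<subseteq> I \<longrightarrow> normal_or_const M (\<lambda>\<omega>. \<Sum>i\<in>J. c i * X i \<omega>))"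

text \<open>The law N_n(m, S), possibly degenerate, as the distribution of m + A Z, where Z is a vector
  of n independent standard normal variables and A is an n by n matrix with A A^T = S. The law does
  not depend on the choice of A, and such an A exists whenever S is symmetric and positive
  semidefinite. Vectors and matrices are indexed by 1,...,n; other entries are ignored.\<close>

definition matrix_factor :: "nat \<Rightarrow> (nat \<Rightarrow> nat \<Rightarrow> real) \<Rightarrow> (nat \<Rightarrow> nat \<Rightarrow> real)" where
  "matrix_factor n S =
     (SOME A. \<forall>i\<in>{1..n}. \<forall>j\<in>{1..n}. (\<Sum>k=1..n. A i k * A j k) = S i j)"

definition multivariate_normal ::
    "nat \<Rightarrow> (nat \<Rightarrow> real) \<Rightarrow> (nat \<Rightarrow> nat \<Rightarrow> real) \<Rightarrow> (nat \<Rightarrow> real) measure" where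
  "multivariate_normal n m S =
     distr (\<Pi>\<^sub>M k\<in>{1..n}. std_normal_distribution) (\<Pi>\<^sub>M i\<in>{1..n}. borel)
       (\<lambda>z. \<lambda>i\<in>{1..n}. m i + (\<Sum>k=1..n. matrix_factor n S i k * z k))"

text \<open>Under the global null the vector of test statistics has law N_n(0, S).\<close>

definition FWER :: "nat \<Rightarrow> real \<Rightarrow> (nat \<Rightarrow> nat \<Rightarrow> real) \<Rightarrow> real" where
  "FWER n \<alpha> S =
     measure (multivariate_normal n (\<lambda>_. 0) S)
       (\<Union>i\<in>{1..n}. {x \<in> space (multivariate_normal n (\<lambda>_. 0) S).
          x i > std_normal_quantile (1 - \<alpha> / real n)})"

end

theory Submission
  imports Defs "HOL-Real_Asymp.Real_Asymp"
begin

text \<open>No Gaussian comparison inequality is needed. Fix N and 0 < d < 1 with all correlations at least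
  d from index N on, and let W be the average of the variables with indices N,...,n. Every such
  variable has covariance at least d with W, and W has variance at most 1, so X i - d W has variance
  at most 1 - 2 d^2 + d^2 = 1 - d^2. With c the Bonferroni threshold, X i > c forces W > d c / 4 or
  X i - d W > c (1 - d^2 / 4). The first event does not depend on i and has vanishing probability.
  The second has a tail exponent beating that of the standard normal law, since
  (1 - d^2 / 4)^2 > 1 - d^2, so it survives the union bound: n is only of order exp ((c + 1)^2 / 2).\<close>


section \<open>Gram factors of positive semidefinite matrices\<close>

text \<open>A Cholesky elimination by induction on the size: a rank one matrix built from the last
  column is subtracted, the remainder is again positive semidefinite, and its factor is extended by
  one column. Singular matrices are included, so the pivot \<open>p\<close> may be 0. The result
  makes the choice in \<open>matrix_factor\<close> meaningful.\<close>

lemma gram_factorization_exists: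
  fixes S :: "nat \<Rightarrow> nat \<Rightarrow> real"
  assumes "\<And>i j. i \<in> {1..n} \<Longrightarrow> j \<in> {1..n} \<Longrightarrow> S i j = S j i"
    and "\<And>c. 0 \<le> (\<Sum>i=1..n. \<Sum>j=1..n. c i * c j * S i j)"
  shows "\<exists>A. \<forall>i\<in>{1..n}. \<forall>j\<in>{1..n}. (\<Sum>k=1..n. A i k * A j k) = S i j"
  using assms
proof (induction n arbitrary: S)
  case 0
  then show ?case by simp
next
  case (Suc n)
  define p where "p = S (Suc n) (Suc n)"
  define T where "T i j = S i j - S i (Suc n) * S j (Suc n) / p" for i j
  have sym: "S (Suc n) i = S i (Suc n)" if "i \<in> {1..n}" for i
    using Suc.prems(1)[of i "Suc n"] that by simp
  have expand: "(\<Sum>i=1..Suc n. \<Sum>j=1..Suc n. c i * c j * S i j)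
      = (\<Sum>i=1..n. \<Sum>j=1..n. c i * c j * S i j)
        + 2 * c (Suc n) * (\<Sum>i=1..n. c i * S i (Suc n)) + (c (Suc n))\<^sup>2 * p" for c
  proof -
    have "(\<Sum>j=1..n. c (Suc n) * c j * S (Suc n) j) = c (Suc n) * (\<Sum>i=1..n. c i * S i (Suc n))"
      unfolding sum_distrib_left by (intro sum.cong) (auto simp: sym)
    moreover have "(\<Sum>i=1..n. c i * c (Suc n) * S i (Suc n)) = c (Suc n) * (\<Sum>i=1..n. c i * S i (Suc n))"
      unfolding sum_distrib_left by (intro sum.cong) auto
    ultimately show ?thesis
      by (simp add: sum.distrib p_def power2_eq_square)
  qed
  have p_nonneg: "0 \<le> p"
    using Suc.prems(2)[of "\<lambda>i. if i = Suc n then 1 else 0"] unfolding expand by simp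
  have zero_col: "S i (Suc n) = 0" if "p = 0" "i \<in> {1..n}" for i
  proof (rule ccontr)
    assume nz: "S i (Suc n) \<noteq> 0"
    \<comment> \<open>For \<open>p = 0\<close> the quadratic form at e_i + t e_(n+1) is
      \<open>S i i + 2 * t * S i (Suc n)\<close>, which is affine in t; this \<open>t\<close> gives
      it the value -1.\<close>
    define t where "t = - (S i i + 1) / (2 * S i (Suc n))"
    define c where "c = (\<lambda>j. if j = i then 1 else if j = Suc n then t else 0)"
    have "(\<Sum>j=1..n. c j * S j (Suc n)) = (\<Sum>j\<in>{i}. c j * S j (Suc n))"
      by (rule sum.mono_neutral_right) (use that in \<open>auto simp: c_def\<close>)
    moreover have "(\<Sum>j=1..n. \<Sum>l=1..n. c j * c l * S j l) = (\<Sum>j\<in>{i}. \<Sum>l=1..n. c j * c l * S j l)"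
      by (rule sum.mono_neutral_right) (use that in \<open>auto simp: c_def\<close>)
    moreover have "(\<Sum>l=1..n. c i * c l * S i l) = (\<Sum>l\<in>{i}. c i * c l * S i l)"
      by (rule sum.mono_neutral_right) (use that in \<open>auto simp: c_def\<close>)
    ultimately have "0 \<le> S i i + 2 * t * S i (Suc n)"
      using Suc.prems(2)[of c] that unfolding expand by (auto simp: c_def)
    moreover have "2 * t * S i (Suc n) = - (S i i + 1)"
      using nz by (simp add: t_def)
    ultimately show False by simp
  qed
  \<comment> \<open>T is the Schur complement; for p = 0 the last column vanishes and x / 0 = 0 gives T = S.\<close>
  have "\<exists>A. \<forall>i\<in>{1..n}. \<forall>j\<in>{1..n}. (\<Sum>k=1..n. A i k * A j k) = T i j"
  proof (rule Suc.IH)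
    show "T i j = T j i" if "i \<in> {1..n}" "j \<in> {1..n}" for i j
      using Suc.prems(1)[of i j] that by (simp add: T_def)
    show "0 \<le> (\<Sum>i=1..n. \<Sum>j=1..n. c i * c j * T i j)" for c
    proof -
      define L where "L = (\<Sum>i=1..n. c i * S i (Suc n))"
      have "(\<Sum>i=1..n. \<Sum>j=1..n. c i * c j * T i j)
          = (\<Sum>i=1..n. \<Sum>j=1..n. c i * c j * S i j)
            - (\<Sum>i=1..n. \<Sum>j=1..n. (c i * S i (Suc n)) * (c j * S j (Suc n))) / p"
        by (simp add: T_def algebra_simps sum_subtractf sum_divide_distrib)
      also have "(\<Sum>i=1..n. \<Sum>j=1..n. (c i * S i (Suc n)) * (c j * S j (Suc n))) = L\<^sup>2"
        by (simp add: L_def power2_eq_square sum_product)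
      \<comment> \<open>Completing the square: for \<open>p > 0\<close> the value
        \<open>- L / p\<close> of the last coordinate minimizes the full form, and the minimum is
        the form of \<open>T\<close>. For \<open>p = 0\<close> that coordinate is 0 and both sides
        reduce to the form of \<open>S\<close> on the first \<open>n\<close> coordinates.\<close>
      also have "(\<Sum>i=1..n. \<Sum>j=1..n. c i * c j * S i j) - L\<^sup>2 / p
          = (\<Sum>i=1..Suc n. \<Sum>j=1..Suc n. (c(Suc n := - L / p)) i * (c(Suc n := - L / p)) j * S i j)"
      proof -
        have "(\<Sum>i=1..n. (c(Suc n := - L / p)) i * S i (Suc n)) = L"
          unfolding L_def by (intro sum.cong) auto
        moreover have "(\<Sum>i=1..n. \<Sum>j=1..n. (c(Suc n := - L / p)) i * (c(Suc n := - L / p)) j * S i j)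
            = (\<Sum>i=1..n. \<Sum>j=1..n. c i * c j * S i j)"
          by (intro sum.cong) auto
        ultimately show ?thesis
          unfolding expand by (cases "p = 0") (simp_all add: power2_eq_square field_simps)
      qed
      finally show ?thesis
        by (simp only: Suc.prems(2))
    qed
  qed
  then obtain A where A: "\<And>i j. i \<in> {1..n} \<Longrightarrow> j \<in> {1..n} \<Longrightarrow> (\<Sum>k=1..n. A i k * A j k) = T i j"
    by blast
  \<comment> \<open>The new column restores the rank one matrix removed from \<open>S\<close>. The
    last row vanishes outside this column, so products with it see only the new entries.\<close>
  define B where "B i k = (if k = Suc n then S i (Suc n) / sqrt p else if i = Suc n then 0 else A i k)"
    for i k
  have last_col: "B i (Suc n) * B j (Suc n) = S i (Suc n) * S j (Suc n) / p" for i j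
    using p_nonneg by (simp add: B_def)
  have "(\<Sum>k=1..Suc n. B i k * B j k) = S i j" if "i \<in> {1..Suc n}" "j \<in> {1..Suc n}" for i j
  proof (cases "i = Suc n \<or> j = Suc n")
    case True
    then have "(\<Sum>k=1..n. B i k * B j k) = 0"
      by (intro sum.neutral) (auto simp: B_def)
    then have "(\<Sum>k=1..Suc n. B i k * B j k) = S i (Suc n) * S j (Suc n) / p"
      by (simp add: last_col)
    also have "\<dots> = S i j"
      using True that zero_col sym by (cases "p = 0") (auto simp: p_def le_Suc_eq)
    finally show ?thesis .
  next
    case False
    then have ij: "i \<in> {1..n}" "j \<in> {1..n}" using that by auto
    have "(\<Sum>k=1..n. B i k * B j k) = (\<Sum>k=1..n. A i k * A j k)"
      by (intro sum.cong) (use False in \<open>auto simp: B_def\<close>)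
    then show ?thesis
      using A[OF ij] by (simp add: last_col T_def)
  qed
  then show ?case by blast
qed

section \<open>Tails of linear combinations of independent normals\<close>

text \<open>Completing the square turns the exponentially tilted standard normal density into
  \<open>exp (s\<^sup>2 / 2)\<close> times the normal density with mean \<open>s\<close>.\<close>

lemma std_normal_mgf:
  "(\<integral>\<^sup>+x. ennreal (exp (s * x)) \<partial>std_normal_distribution) = ennreal (exp (s\<^sup>2 / 2))"
proof -
  have "(\<integral>\<^sup>+x. ennreal (exp (s * x)) \<partial>std_normal_distribution)
      = (\<integral>\<^sup>+x. ennreal (exp (s\<^sup>2 / 2)) * ennreal (normal_density s 1 x) \<partial>lborel)"
  proof (subst nn_integral_density; (intro nn_integral_cong)?)
    fix x :: real
    have "std_normal_density x * exp (s * x) = exp (s\<^sup>2 / 2) * normal_density s 1 x"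
      by (simp add: normal_density_def exp_add[symmetric] power2_eq_square field_simps)
    then show "ennreal (std_normal_density x) * ennreal (exp (s * x))
        = ennreal (exp (s\<^sup>2 / 2)) * ennreal (normal_density s 1 x)"
      by (simp add: ennreal_mult'[symmetric])
  qed auto
  also have "\<dots> = ennreal (exp (s\<^sup>2 / 2)) * (\<integral>\<^sup>+x. ennreal (normal_density s 1 x) \<partial>lborel)"
    by (rule nn_integral_cmult) auto
  also have "(\<integral>\<^sup>+x. ennreal (normal_density s 1 x) \<partial>lborel) = 1"
    by (subst nn_integral_eq_integral) auto
  finally show ?thesis by simp
qed

text \<open>Chernoff's bound, with the moment generating function factorizing over the product
  measure. Since \<open>v\<close> only bounds the variance from above, degenerate combinations are
  covered as well.\<close>

lemma std_normal_linear_tail: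
  fixes b :: "'i \<Rightarrow> real"
  assumes I: "finite I" and v: "(\<Sum>k\<in>I. (b k)\<^sup>2) \<le> v" "0 < v" and t: "0 < t"
  defines "Q \<equiv> PiM I (\<lambda>_. std_normal_distribution)"
  shows "measure Q {z \<in> space Q. t < (\<Sum>k\<in>I. b k * z k)} \<le> exp (- t\<^sup>2 / (2 * v))"
proof -
  interpret N: prob_space std_normal_distribution
    by (rule prob_space_normal_density) simp
  interpret P: product_prob_space "\<lambda>_::'i. std_normal_distribution" I
    by unfold_locales
  interpret Q: prob_space Q
    unfolding Q_def by (rule prob_space_PiM) (rule N.prob_space_axioms)
  \<comment> \<open>This is the minimizer of the Chernoff exponent
    \<open>- s * t + s\<^sup>2 / 2 * v\<close>.\<close>
  define s where "s = t / v"
  have s: "0 < s" using v t by (simp add: s_def)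
  have meas: "(\<lambda>z. \<Sum>k\<in>I. b k * z k) \<in> borel_measurable Q"
  proof (intro borel_measurable_sum borel_measurable_times borel_measurable_const)
    fix k assume "k \<in> I"
    then have "(\<lambda>z. z k) \<in> measurable Q std_normal_distribution"
      unfolding Q_def by (rule measurable_component_singleton)
    then show "(\<lambda>z. z k) \<in> borel_measurable Q" by simp
  qed
  have "measure Q {z \<in> space Q. t < (\<Sum>k\<in>I. b k * z k)}
      \<le> measure Q {z \<in> space Q. t \<le> (\<Sum>k\<in>I. b k * z k)}"
    using meas by (intro Q.finite_measure_mono) auto
  then have "ennreal (measure Q {z \<in> space Q. t < (\<Sum>k\<in>I. b k * z k)})
      \<le> ennreal (measure Q {z \<in> space Q. t \<le> (\<Sum>k\<in>I. b k * z k)})"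
    by (rule ennreal_leI)
  also have "\<dots> \<le> ennreal (exp (- s * t)) * (\<integral>\<^sup>+z. ennreal (exp (s * (\<Sum>k\<in>I. b k * z k))) \<partial>Q)"
    using Chernoff_ineq_nn_integral_ge[OF s, of "space Q" Q "\<lambda>z. \<Sum>k\<in>I. b k * z k" t] meas
    by (simp add: Q.emeasure_eq_measure nn_integral_set_ennreal[symmetric] cong: nn_integral_cong_simp)
  also have "(\<integral>\<^sup>+z. ennreal (exp (s * (\<Sum>k\<in>I. b k * z k))) \<partial>Q)
      = (\<integral>\<^sup>+z. (\<Prod>k\<in>I. ennreal (exp ((s * b k) * z k))) \<partial>Q)"
    using I by (simp add: prod_ennreal exp_sum sum_distrib_left mult.assoc)
  also have "\<dots> = (\<Prod>k\<in>I. \<integral>\<^sup>+x. ennreal (exp ((s * b k) * x)) \<partial>std_normal_distribution)"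
    unfolding Q_def by (rule P.product_nn_integral_prod) (use I in auto)
  also have "\<dots> = ennreal (exp (s\<^sup>2 / 2 * (\<Sum>k\<in>I. (b k)\<^sup>2)))"
    using I by (simp add: std_normal_mgf prod_ennreal exp_sum sum_distrib_left power_mult_distrib)
  also have "\<dots> \<le> ennreal (exp (s\<^sup>2 / 2 * v))"
    using v by (intro ennreal_leI) (simp add: mult_left_mono)
  also have "ennreal (exp (- s * t)) * ennreal (exp (s\<^sup>2 / 2 * v)) = ennreal (exp (- t\<^sup>2 / (2 * v)))"
  proof -
    have "- s * t + s\<^sup>2 / 2 * v = - t\<^sup>2 / (2 * v)"
      using v by (simp add: s_def field_simps power2_eq_square)
    then show ?thesis
      by (simp add: ennreal_mult'[symmetric] exp_add[symmetric])
  qed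
  finally show ?thesis
    by (simp add: ennreal_le_iff mult_left_mono)
qed

text \<open>The rows \<open>a i\<close> encode unit variance normals, and inner products of rows are
  their covariances. The three summands come from a plain union bound over \<open>I\<close>, where
  the correlations are uncontrolled, from the average over \<open>J\<close>, and from a union bound
  over the residuals of \<open>J\<close>.\<close>

lemma max_correlated_normals_tail:
  fixes a :: "'j \<Rightarrow> 'i \<Rightarrow> real"
  assumes K: "finite K" and I: "finite I" and J: "finite J" "J \<noteq> {}"
    and var: "\<And>i. i \<in> I \<union> J \<Longrightarrow> (\<Sum>k\<in>K. (a i k)\<^sup>2) = 1"
    and cor: "\<And>i j. i \<in> J \<Longrightarrow> j \<in> J \<Longrightarrow> (\<Sum>k\<in>K. a i k * a j k) \<in> {d..1}"
    and d: "0 < d" "d < 1" and c: "0 < c"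
  defines "Q \<equiv> PiM K (\<lambda>_. std_normal_distribution)"
  shows "measure Q {z \<in> space Q. \<exists>i\<in>I \<union> J. c < (\<Sum>k\<in>K. a i k * z k)}
    \<le> real (card I) * exp (- c\<^sup>2 / 2) + exp (- (d / 4 * c)\<^sup>2 / 2)
      + real (card J) * exp (- (c * (1 - d\<^sup>2 / 4))\<^sup>2 / (2 * (1 - d\<^sup>2)))"
proof -
  interpret N: prob_space std_normal_distribution
    by (rule prob_space_normal_density) simp
  interpret Q: prob_space Q
    unfolding Q_def by (rule prob_space_PiM) (rule N.prob_space_axioms)
  \<comment> \<open>The coefficient vector of the average over \<open>J\<close>.\<close>
  define w where "w k = (\<Sum>j\<in>J. a j k) / real (card J)" for k
  have m: "0 < real (card J)" using J by (simp add: card_gt_0_iff)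
  have cov_w: "(\<Sum>k\<in>K. a i k * w k) = (\<Sum>j\<in>J. \<Sum>k\<in>K. a i k * a j k) / real (card J)" for i
  proof -
    have "(\<Sum>k\<in>K. a i k * w k) = (\<Sum>k\<in>K. \<Sum>j\<in>J. a i k * a j k) / real (card J)"
      by (simp add: w_def sum_divide_distrib sum_distrib_left)
    then show ?thesis by (subst sum.swap)
  qed
  have cov_bounds: "d \<le> (\<Sum>k\<in>K. a i k * w k)" "(\<Sum>k\<in>K. a i k * w k) \<le> 1" if "i \<in> J" for i
    using sum_bounded_below[of J d "\<lambda>j. \<Sum>k\<in>K. a i k * a j k"]
      sum_bounded_above[of J "\<lambda>j. \<Sum>k\<in>K. a i k * a j k" 1] cor[OF that] m
    unfolding cov_w by (auto simp: pos_le_divide_eq mult.commute[of d])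
  \<comment> \<open>The variance of the average is the mean of its covariances with the members of
    \<open>J\<close>, each at most 1.\<close>
  have var_w: "(\<Sum>k\<in>K. (w k)\<^sup>2) \<le> 1"
  proof -
    have "(\<Sum>k\<in>K. (w k)\<^sup>2) = (\<Sum>k\<in>K. \<Sum>j\<in>J. a j k * w k) / real (card J)"
      by (simp add: w_def power2_eq_square sum_divide_distrib sum_distrib_left sum_distrib_right
          mult.commute)
    also have "\<dots> = (\<Sum>j\<in>J. \<Sum>k\<in>K. a j k * w k) / real (card J)"
      by (subst sum.swap) simp
    also have "\<dots> \<le> 1"
      using sum_bounded_above[of J "\<lambda>j. \<Sum>k\<in>K. a j k * w k" 1] cov_bounds(2) m by simp
    finally show ?thesis .
  qed
  have var_resid: "(\<Sum>k\<in>K. (a i k - d * w k)\<^sup>2) \<le> 1 - d\<^sup>2" if "i \<in> J" for i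
  proof -
    have "(\<Sum>k\<in>K. (a i k - d * w k)\<^sup>2)
        = (\<Sum>k\<in>K. (a i k)\<^sup>2) - 2 * d * (\<Sum>k\<in>K. a i k * w k) + d\<^sup>2 * (\<Sum>k\<in>K. (w k)\<^sup>2)"
      by (simp add: power2_eq_square algebra_simps sum.distrib sum_subtractf sum_distrib_left)
    also have "\<dots> \<le> 1 - 2 * d * d + d\<^sup>2 * 1"
      using cov_bounds(1)[OF that] var_w var[of i] that d
      by (intro add_mono diff_mono mult_left_mono) auto
    finally show ?thesis by (simp add: power2_eq_square)
  qed
  define E where "E b t = {z \<in> space Q. t < (\<Sum>k\<in>K. b k * z k)}" for b t
  have E_sets[measurable]: "E b t \<in> sets Q" for b t
  proof -
    have "(\<lambda>z. \<Sum>k\<in>K. b k * z k) \<in> borel_measurable Q"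
    proof (intro borel_measurable_sum borel_measurable_times borel_measurable_const)
      fix k assume "k \<in> K"
      then have "(\<lambda>z. z k) \<in> measurable Q std_normal_distribution"
        unfolding Q_def by (rule measurable_component_singleton)
      then show "(\<lambda>z. z k) \<in> borel_measurable Q" by simp
    qed
    then show ?thesis unfolding E_def by measurable
  qed
  have tail: "measure Q (E b t) \<le> exp (- t\<^sup>2 / (2 * v))"
    if "(\<Sum>k\<in>K. (b k)\<^sup>2) \<le> v" "0 < v" "0 < t" for b t v
    unfolding E_def Q_def by (rule std_normal_linear_tail[OF K that])
  \<comment> \<open>What remains of \<open>c\<close> once the shared part \<open>d * w\<close> has
    contributed at most \<open>d * (d / 4 * c)\<close>. Any fraction in (0, 1/2] in place of 1/4
    would keep the square of the remaining factor above 1 - d^2.\<close>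
  define t where "t = c * (1 - d\<^sup>2 / 4)"
  have d2: "d\<^sup>2 < 1" using d by (simp add: power_less_one_iff)
  then have t: "0 < t" using c by (simp add: t_def)
  have "{z \<in> space Q. \<exists>i\<in>I \<union> J. c < (\<Sum>k\<in>K. a i k * z k)}
      \<subseteq> (\<Union>i\<in>I. E (a i) c) \<union> E w (d / 4 * c) \<union> (\<Union>i\<in>J. E (\<lambda>k. a i k - d * w k) t)"
  proof safe
    \<comment> \<open>For \<open>i\<close> in \<open>J\<close> the two negated events are
      incompatible: an average of at most \<open>d / 4 * c\<close> forces the residual of
      \<open>i\<close> above \<open>t\<close>.\<close>
    fix z i assume z: "z \<in> space Q" "i \<in> J" "c < (\<Sum>k\<in>K. a i k * z k)"
      and not_res: "z \<notin> (\<Union>i\<in>J. E (\<lambda>k. a i k - d * w k) t)" and not_w: "z \<notin> E w (d / 4 * c)"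
    have "(\<Sum>k\<in>K. w k * z k) \<le> d / 4 * c" using not_w z by (simp add: E_def)
    then have "d * (\<Sum>k\<in>K. w k * z k) \<le> d * (d / 4 * c)" using d by (intro mult_left_mono) auto
    moreover have "(\<Sum>k\<in>K. (a i k - d * w k) * z k)
        = (\<Sum>k\<in>K. a i k * z k) - d * (\<Sum>k\<in>K. w k * z k)"
      by (simp add: algebra_simps sum_subtractf sum_distrib_left)
    moreover have "c - d * (d / 4 * c) = t" by (simp add: t_def algebra_simps power2_eq_square)
    ultimately have "t < (\<Sum>k\<in>K. (a i k - d * w k) * z k)" using z by linarith
    then have "z \<in> E (\<lambda>k. a i k - d * w k) t" using z by (simp add: E_def)
    with not_res z show "z \<in> (\<Union>i\<in>I. E (a i) c)" by blast
  qed (auto simp: E_def)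
  then have "measure Q {z \<in> space Q. \<exists>i\<in>I \<union> J. c < (\<Sum>k\<in>K. a i k * z k)}
      \<le> measure Q ((\<Union>i\<in>I. E (a i) c) \<union> E w (d / 4 * c) \<union> (\<Union>i\<in>J. E (\<lambda>k. a i k - d * w k) t))"
    using I J(1) by (intro Q.finite_measure_mono sets.Un sets.finite_UN E_sets)
  also have "\<dots> \<le> measure Q ((\<Union>i\<in>I. E (a i) c) \<union> E w (d / 4 * c))
      + measure Q (\<Union>i\<in>J. E (\<lambda>k. a i k - d * w k) t)"
    using I J(1) by (intro measure_Un_le sets.Un sets.finite_UN E_sets)
  also have "measure Q ((\<Union>i\<in>I. E (a i) c) \<union> E w (d / 4 * c))
      \<le> measure Q (\<Union>i\<in>I. E (a i) c) + measure Q (E w (d / 4 * c))"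
    using I by (intro measure_Un_le sets.finite_UN E_sets)
  also have "measure Q (\<Union>i\<in>I. E (a i) c) + measure Q (E w (d / 4 * c))
      + measure Q (\<Union>i\<in>J. E (\<lambda>k. a i k - d * w k) t)
      \<le> real (card I) * exp (- c\<^sup>2 / 2) + exp (- (d / 4 * c)\<^sup>2 / 2)
      + real (card J) * exp (- t\<^sup>2 / (2 * (1 - d\<^sup>2)))"
  proof (intro add_mono)
    have "measure Q (\<Union>i\<in>I. E (a i) c) \<le> (\<Sum>i\<in>I. measure Q (E (a i) c))"
      using I by (intro Q.finite_measure_subadditive_finite) auto
    also have "\<dots> \<le> real (card I) * exp (- c\<^sup>2 / 2)"
    proof (rule sum_bounded_above)
      show "measure Q (E (a i) c) \<le> exp (- c\<^sup>2 / 2)" if "i \<in> I" for i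
        using tail[of "a i" 1 c] var[of i] that c by simp
    qed
    finally show "measure Q (\<Union>i\<in>I. E (a i) c) \<le> real (card I) * exp (- c\<^sup>2 / 2)" .
    show "measure Q (E w (d / 4 * c)) \<le> exp (- (d / 4 * c)\<^sup>2 / 2)"
      using tail[OF var_w, of "d / 4 * c"] d c by simp
    have "measure Q (\<Union>i\<in>J. E (\<lambda>k. a i k - d * w k) t)
        \<le> (\<Sum>i\<in>J. measure Q (E (\<lambda>k. a i k - d * w k) t))"
      using J by (intro Q.finite_measure_subadditive_finite) auto
    also have "\<dots> \<le> real (card J) * exp (- t\<^sup>2 / (2 * (1 - d\<^sup>2)))"
      by (rule sum_bounded_above, rule tail[OF var_resid]) (use d2 t in auto)
    finally show "measure Q (\<Union>i\<in>J. E (\<lambda>k. a i k - d * w k) t)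
        \<le> real (card J) * exp (- t\<^sup>2 / (2 * (1 - d\<^sup>2)))" .
  qed
  finally show ?thesis by (simp add: t_def)
qed

section \<open>Normal quantiles and the size of the Bonferroni threshold\<close>

text \<open>The quantile is \<open>inv\<close> of a function that is not onto the reals, so
  \<open>p\<close> has to be an attained value. The law has no atoms, hence its cdf is continuous,
  and the intermediate value theorem applies between its limits 0 and 1.\<close>

lemma std_normal_cdf_quantile:
  assumes "0 < p" "p < 1"
  shows "std_normal_cdf (std_normal_quantile p) = p"
proof -
  interpret real_distribution std_normal_distribution by (rule real_dist_normal_dist)
  have cont: "isCont std_normal_cdf x" for x
  proof -
    have "AE y in lborel. ennreal (std_normal_density y) * indicator {x} y = 0"
      using AE_lborel_singleton[of x] by eventually_elim simp
    then have "emeasure std_normal_distribution {x} = 0"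
      by (subst emeasure_density) (auto simp: nn_integral_0_iff_AE)
    then show ?thesis by (simp add: isCont_cdf measure_def)
  qed
  have "eventually (\<lambda>x. std_normal_cdf x < p) at_bot"
    using order_tendstoD(2)[OF cdf_lim_at_bot] assms by blast
  then obtain l where l: "std_normal_cdf l < p"
    using eventually_happens by (metis trivial_limit_at_bot_linorder)
  have "eventually (\<lambda>x. p < std_normal_cdf x) at_top"
    using order_tendstoD(1)[OF cdf_lim_at_top_prob] assms by blast
  then obtain u where u: "p < std_normal_cdf u"
    using eventually_happens by (metis trivial_limit_at_top_linorder)
  have "l \<le> u" using l u cdf_nondecreasing[of u l] by linarith
  then obtain x where "std_normal_cdf x = p"
    using IVT[of std_normal_cdf l p u] l u cont by force
  then show ?thesis
    unfolding std_normal_quantile_def by (intro f_inv_into_f) auto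
qed

text \<open>On the unit interval to the right of \<open>c\<close> the density is at least its value
  at \<open>c + 1\<close>. The shift from \<open>c\<close> to \<open>c + 1\<close> costs only a
  factor exp(c + 1/2), which a gain quadratic in \<open>c\<close> in the exponent absorbs
  later.\<close>

lemma std_normal_cdf_le:
  assumes "0 \<le> c"
  shows "std_normal_cdf c \<le> 1 - exp (- (c + 1)\<^sup>2 / 2) / sqrt (2 * pi)"
proof -
  interpret real_distribution std_normal_distribution by (rule real_dist_normal_dist)
  let ?m = "exp (- (c + 1)\<^sup>2 / 2) / sqrt (2 * pi)"
  have "ennreal ?m = (\<integral>\<^sup>+x. ennreal ?m * indicator {c<..c+1} x \<partial>lborel)"
    by (subst nn_integral_cmult_indicator) auto
  also have "\<dots> \<le> (\<integral>\<^sup>+x. ennreal (std_normal_density x) * indicator {c<..c+1} x \<partial>lborel)"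
  proof (intro nn_integral_mono)
    fix x
    have "x\<^sup>2 \<le> (c + 1)\<^sup>2" if "c < x" "x \<le> c + 1"
      using that assms by (intro power_mono) auto
    then show "ennreal ?m * indicator {c<..c+1} x \<le> ennreal (std_normal_density x) * indicator {c<..c+1} x"
      by (auto simp: indicator_def std_normal_density_def intro!: ennreal_leI divide_right_mono)
  qed
  also have "\<dots> = emeasure std_normal_distribution {c<..c+1}"
    by (subst emeasure_density) auto
  finally have "?m \<le> measure std_normal_distribution {c<..c+1}"
    by (simp add: emeasure_eq_measure ennreal_le_iff)
  also have "\<dots> = std_normal_cdf (c + 1) - std_normal_cdf c"
    by (rule cdf_diff_eq[symmetric]) simp
  also have "\<dots> \<le> 1 - std_normal_cdf c"
    using cdf_bounded_prob[of "c + 1"] by simp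
  finally show ?thesis by simp
qed

text \<open>The cdf at any fixed \<open>B\<close> is below 1, so
  \<open>1 - \<alpha> / real n\<close> eventually exceeds it, and monotonicity puts the quantile
  beyond \<open>B\<close>.\<close>

lemma filterlim_bonferroni_threshold:
  assumes "0 < \<alpha>" "\<alpha> < 1"
  shows "filterlim (\<lambda>n. std_normal_quantile (1 - \<alpha> / real n)) at_top sequentially"
  unfolding filterlim_at_top_gt[where c = 0]
proof (intro allI impI)
  fix B :: real assume "0 < B"
  interpret real_distribution std_normal_distribution by (rule real_dist_normal_dist)
  have "std_normal_cdf B < 1"
    using std_normal_cdf_le[of B] \<open>0 < B\<close> by (smt (verit) divide_pos_pos exp_gt_zero pi_gt_zero real_sqrt_gt_zero)
  moreover have "(\<lambda>n. 1 - \<alpha> / real n) \<longlonglongrightarrow> 1" by real_asymp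
  ultimately have "eventually (\<lambda>n. std_normal_cdf B < 1 - \<alpha> / real n) sequentially"
    by (rule order_tendstoD(1)[rotated])
  then show "eventually (\<lambda>n. B \<le> std_normal_quantile (1 - \<alpha> / real n)) sequentially"
    \<comment> \<open>At \<open>n = 0\<close> the convention x / 0 = 0 would give the argument 1,
      which lies outside (0,1).\<close>
    using eventually_ge_at_top[of 1]
  proof eventually_elim
    case (elim n)
    then have "\<alpha> / real n < 1" using assms by (simp add: divide_less_eq)
    then have "std_normal_cdf (std_normal_quantile (1 - \<alpha> / real n)) = 1 - \<alpha> / real n"
      using assms elim by (intro std_normal_cdf_quantile) auto
    then show ?case
      using elim cdf_nondecreasing[of "std_normal_quantile (1 - \<alpha> / real n)" B] by linarith
  qed
qed

text \<open>The upper tail at the threshold is exactly \<open>\<alpha> / real n\<close>; inverting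
  its lower bound expresses the number of hypotheses through the threshold, so that a union bound
  over them becomes a function of \<open>c\<close> alone.\<close>

lemma bonferroni_threshold_growth:
  assumes "0 < \<alpha>" "\<alpha> < 1" "1 \<le> n" and c: "0 \<le> c" "c = std_normal_quantile (1 - \<alpha> / real n)"
  shows "real n \<le> \<alpha> * sqrt (2 * pi) * exp ((c + 1)\<^sup>2 / 2)"
proof -
  have "\<alpha> / real n < 1" using assms by (simp add: divide_less_eq)
  then have "std_normal_cdf c = 1 - \<alpha> / real n"
    unfolding c using assms by (intro std_normal_cdf_quantile) auto
  then have "exp (- (c + 1)\<^sup>2 / 2) / sqrt (2 * pi) \<le> \<alpha> / real n"
    using std_normal_cdf_le[OF c(1)] by simp
  then show ?thesis
    using assms by (simp add: exp_minus field_simps)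
qed

section \<open>The error rate on independent normals, and covariance matrices\<close>

text \<open>The rejection event is pulled back along the linear map that defines the multivariate
  law. This gives the form of \<open>max_correlated_normals_tail\<close>, with the rows of the
  factor as \<open>a i\<close>.\<close>

lemma FWER_eq_measure_factor:
  "FWER n \<alpha> S = measure (\<Pi>\<^sub>M k\<in>{1..n}. std_normal_distribution)
     {z \<in> space (\<Pi>\<^sub>M k\<in>{1..n}. std_normal_distribution).
        \<exists>i\<in>{1..n}. std_normal_quantile (1 - \<alpha> / real n) < (\<Sum>k=1..n. matrix_factor n S i k * z k)}"
proof -
  let ?Q = "\<Pi>\<^sub>M k\<in>{1..n}. std_normal_distribution"
  let ?q = "std_normal_quantile (1 - \<alpha> / real n)"
  let ?B = "\<Pi>\<^sub>M i\<in>{1..n}. (borel :: real measure)"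
  let ?f = "\<lambda>z. \<lambda>i\<in>{1..n}. 0 + (\<Sum>k=1..n. matrix_factor n S i k * z k)"
  have f: "?f \<in> measurable ?Q ?B"
  proof (intro measurable_restrict borel_measurable_add borel_measurable_sum borel_measurable_times
      borel_measurable_const)
    fix k assume "k \<in> {1..n}"
    then have "(\<lambda>z. z k) \<in> measurable ?Q std_normal_distribution"
      by (rule measurable_component_singleton)
    then show "(\<lambda>z. z k) \<in> borel_measurable ?Q" by simp
  qed
  have comp: "{x \<in> space ?B. ?q < x i} \<in> sets ?B" if "i \<in> {1..n}" for i
    using that by measurable
  have "FWER n \<alpha> S = measure (distr ?Q ?B ?f) (\<Union>i\<in>{1..n}. {x \<in> space ?B. ?q < x i})"
    by (simp add: FWER_def multivariate_normal_def)
  also have "\<dots> = measure ?Q (?f -` (\<Union>i\<in>{1..n}. {x \<in> space ?B. ?q < x i}) \<inter> space ?Q)"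
    using f comp by (intro measure_distr) auto
  also have "?f -` (\<Union>i\<in>{1..n}. {x \<in> space ?B. ?q < x i}) \<inter> space ?Q
      = {z \<in> space ?Q. \<exists>i\<in>{1..n}. ?q < (\<Sum>k=1..n. matrix_factor n S i k * z k)}"
    using measurable_space[OF f] by (auto 0 0 simp: Bex_def; blast)
  finally show ?thesis .
qed

lemma matrix_factor_gram:
  assumes "\<And>i j. i \<in> {1..n} \<Longrightarrow> j \<in> {1..n} \<Longrightarrow> S i j = S j i"
    and "\<And>c. 0 \<le> (\<Sum>i=1..n. \<Sum>j=1..n. c i * c j * S i j)"
    and "i \<in> {1..n}" "j \<in> {1..n}"
  shows "(\<Sum>k=1..n. matrix_factor n S i k * matrix_factor n S j k) = S i j"
  using someI_ex[OF gram_factorization_exists[OF assms(1,2)]] assms(3,4)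
  unfolding matrix_factor_def by blast

lemma covariance_sym: "covariance M X Y = covariance M Y X"
  by (simp add: covariance_def mult.commute)

text \<open>The double sum is the integral of the square of the linear combination of the centred
  variables. Square integrability makes their products integrable, which allows the sums and the
  integral to be exchanged.\<close>

lemma covariance_psd:
  fixes X :: "'i \<Rightarrow> 'a \<Rightarrow> real"
  assumes meas: "\<And>i. i \<in> I \<Longrightarrow> X i \<in> borel_measurable M"
    and sq: "\<And>i. i \<in> I \<Longrightarrow> integrable M (\<lambda>\<omega>. (X i \<omega> - integral\<^sup>L M (X i))\<^sup>2)"
  shows "0 \<le> (\<Sum>i\<in>I. \<Sum>j\<in>I. c i * c j * covariance M (X i) (X j))"
proof -
  define Y where "Y i \<omega> = X i \<omega> - integral\<^sup>L M (X i)" for i \<omega>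
  have Y: "Y i \<in> borel_measurable M" "integrable M (\<lambda>\<omega>. (Y i \<omega>)\<^sup>2)" if "i \<in> I" for i
    using meas[OF that] sq[OF that] by (auto simp: Y_def[abs_def])
  have int: "integrable M (\<lambda>\<omega>. Y i \<omega> * Y j \<omega>)" if "i \<in> I" "j \<in> I" for i j
  proof (rule Bochner_Integration.integrable_bound)
    show "integrable M (\<lambda>\<omega>. (Y i \<omega>)\<^sup>2 + (Y j \<omega>)\<^sup>2)" using Y that by simp
    show "(\<lambda>\<omega>. Y i \<omega> * Y j \<omega>) \<in> borel_measurable M" using Y that by simp
    have "\<bar>x * y\<bar> \<le> x\<^sup>2 + y\<^sup>2" for x y :: real
    proof -
      have "0 \<le> \<bar>x\<bar> * \<bar>y\<bar>" by simp
      moreover have "2 * (\<bar>x\<bar> * \<bar>y\<bar>) \<le> x\<^sup>2 + y\<^sup>2"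
        using sum_squares_bound[of "\<bar>x\<bar>" "\<bar>y\<bar>"] by (simp add: mult.assoc)
      ultimately show ?thesis unfolding abs_mult by linarith
    qed
    then show "AE \<omega> in M. norm (Y i \<omega> * Y j \<omega>) \<le> norm ((Y i \<omega>)\<^sup>2 + (Y j \<omega>)\<^sup>2)"
      by (auto simp: abs_of_nonneg)
  qed
  have "(\<Sum>i\<in>I. \<Sum>j\<in>I. c i * c j * covariance M (X i) (X j))
      = (\<integral>\<omega>. (\<Sum>i\<in>I. \<Sum>j\<in>I. c i * c j * (Y i \<omega> * Y j \<omega>)) \<partial>M)"
    using int by (simp add: covariance_def Y_def[symmetric] Bochner_Integration.integral_sum)
  also have "\<dots> = (\<integral>\<omega>. (\<Sum>i\<in>I. c i * Y i \<omega>)\<^sup>2 \<partial>M)"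
    by (simp add: power2_eq_square sum_product mult_ac)
  also have "\<dots> \<ge> 0" by (rule Bochner_Integration.integral_nonneg) simp
  finally show ?thesis .
qed

lemma (in prob_space) normal_square_integrable:
  assumes "distributed M lborel X (normal_density \<mu> \<sigma>)" "0 < \<sigma>"
  shows "integrable M (\<lambda>\<omega>. (X \<omega> - \<mu>)\<^sup>2)"
  using distributed_integrable[OF assms(1), of "\<lambda>x. (x - \<mu>)\<^sup>2"] integrable_normal_moment[OF assms(2)]
  by simp

section \<open>Asymptotics of the bound in the threshold\<close>

text \<open>Only the last summand is delicate: its growing factor stands for the number of
  hypotheses at threshold \<open>c\<close>, and the residual tail has to beat it.\<close>

lemma bonferroni_bound_tendsto_0:
  assumes d: "0 < d" "d < 1"
  shows "((\<lambda>c. m * exp (- c\<^sup>2 / 2) + exp (- (d / 4 * c)\<^sup>2 / 2)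
      + (K * exp ((c + 1)\<^sup>2 / 2)) * exp (- (c * (1 - d\<^sup>2 / 4))\<^sup>2 / (2 * (1 - d\<^sup>2)))) \<longlongrightarrow> (0::real)) at_top"
proof -
  \<comment> \<open>The residual tail has exponent \<open>(1 + e) / 2 * c\<^sup>2\<close>, so
    \<open>e\<close> measures its excess over the standard normal exponent.\<close>
  define e where "e = (1 - d\<^sup>2 / 4)\<^sup>2 / (1 - d\<^sup>2) - 1"
  have d2: "0 < d\<^sup>2" "d\<^sup>2 < 1" using d by (auto simp: power_less_one_iff)
  have "1 - d\<^sup>2 < (1 - d\<^sup>2 / 4)\<^sup>2"
  proof -
    have "(1 - u / 4)\<^sup>2 = 1 - u / 2 + (u / 4)\<^sup>2" for u :: real
      by (simp add: power2_eq_square field_simps)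
    from this[of "d\<^sup>2"] show ?thesis
      using d2 zero_le_power2[of "d\<^sup>2 / 4"] by linarith
  qed
  then have e: "0 < e" using d2 by (simp add: e_def)
  have "exp ((c + 1)\<^sup>2 / 2) * exp (- (c * (1 - d\<^sup>2 / 4))\<^sup>2 / (2 * (1 - d\<^sup>2)))
      = exp (c + 1 / 2 - e / 2 * c\<^sup>2)" for c :: real
  proof -
    have "(c * (1 - d\<^sup>2 / 4))\<^sup>2 / (2 * (1 - d\<^sup>2)) = (1 + e) / 2 * c\<^sup>2"
      by (simp add: e_def power_mult_distrib mult.commute)
    moreover have "(c + 1)\<^sup>2 / 2 - (1 + e) / 2 * c\<^sup>2 = c + 1 / 2 - e / 2 * c\<^sup>2"
      by (simp add: power2_eq_square field_simps)
    ultimately have "(c + 1)\<^sup>2 / 2 + - (c * (1 - d\<^sup>2 / 4))\<^sup>2 / (2 * (1 - d\<^sup>2)) = c + 1 / 2 - e / 2 * c\<^sup>2"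
      by simp
    then show ?thesis unfolding exp_add[symmetric] by (rule arg_cong)
  qed
  moreover have "((\<lambda>c. m * exp (- c\<^sup>2 / 2) + exp (- (d / 4 * c)\<^sup>2 / 2)
      + K * exp (c + 1 / 2 - e / 2 * c\<^sup>2)) \<longlongrightarrow> 0) at_top"
  proof -
    have gauss: "((\<lambda>c::real. exp (- c\<^sup>2 / 2)) \<longlongrightarrow> 0) at_top" by real_asymp
    have wide: "((\<lambda>c::real. exp (- (d / 4 * c)\<^sup>2 / 2)) \<longlongrightarrow> 0) at_top"
      by (rule filterlim_compose[OF gauss filterlim_tendsto_pos_mult_at_top[OF tendsto_const]])
        (use d in \<open>auto simp: filterlim_ident\<close>)
    have "((\<lambda>c::real. exp (c + 1 / 2 - e / 2 * c\<^sup>2)) \<longlongrightarrow> 0) at_top"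
    proof (rule tendsto_sandwich[where f = "\<lambda>_. 0" and h = "\<lambda>c. exp (1 / 2 - c)"])
      show "eventually (\<lambda>c. exp (c + 1 / 2 - e / 2 * c\<^sup>2) \<le> exp (1 / 2 - c)) at_top"
        \<comment> \<open>From here on \<open>e / 2 * c\<^sup>2\<close> is at least
          \<open>2 * c\<close>, which leaves an exponent of at most
          \<open>1 / 2 - c\<close>.\<close>
        using eventually_ge_at_top[of "4 / e"] eventually_ge_at_top[of 0]
      proof eventually_elim
        case (elim c)
        then have "4 * c \<le> e * c * c"
          using e by (intro mult_right_mono) (auto simp: divide_le_eq mult.commute)
        then show ?case by (simp add: power2_eq_square)
      qed
      show "((\<lambda>c::real. exp (1 / 2 - c)) \<longlongrightarrow> 0) at_top" by real_asymp
    qed auto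
    from tendsto_add[OF tendsto_add[OF tendsto_mult[OF tendsto_const[of m] gauss] wide]
        tendsto_mult[OF tendsto_const[of K] this]]
    show ?thesis by simp
  qed
  ultimately show ?thesis by (simp add: mult.assoc)
qed

section \<open>Passage to the limit along the correlation matrices\<close>

theorem theorem3p3:
  fixes M :: "'a measure" and X :: "nat \<Rightarrow> 'a \<Rightarrow> real"
    and \<mu> :: "nat \<Rightarrow> real" and \<rho> :: "nat \<Rightarrow> nat \<Rightarrow> real" and \<delta> \<alpha> :: real
  assumes "prob_space M"
    and "jointly_normal M {1..} X"
    and "\<And>i. 1 \<le> i \<Longrightarrow> distributed M lborel (X i) (normal_density (\<mu> i) 1)"
    and "\<And>i j. 1 \<le> i \<Longrightarrow> 1 \<le> j \<Longrightarrow> i \<noteq> j \<Longrightarrow> correlation M (X i) (X j) = \<rho> i j"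
    and "\<And>i j. 1 \<le> i \<Longrightarrow> 1 \<le> j \<Longrightarrow> i \<noteq> j \<Longrightarrow> \<rho> i j \<in> {0<..1}"
    and "(\<lambda>N. Inf {\<rho> i j | i j. N \<le> i \<and> N \<le> j \<and> i \<noteq> j}) \<longlonglongrightarrow> \<delta>"
    and "\<delta> > 0"
    and "\<alpha> \<in> {0<..<1}"
  shows "(\<lambda>n. FWER n \<alpha> (\<lambda>i j. correlation M (X i) (X j))) \<longlonglongrightarrow> 0"
proof -
  interpret prob_space M by fact
  define S where "S i j = correlation M (X i) (X j)" for i j
  define c where "c n = std_normal_quantile (1 - \<alpha> / real n)" for n
  \<comment> \<open>Half of \<open>\<delta>\<close> leaves strict room below the limit inferior; the
    cap 1/2 keeps 1 - d^2 positive, as \<open>\<delta>\<close> may be 1.\<close>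
  define d where "d = min (\<delta> / 2) (1 / 2)"
  have d: "0 < d" "d < 1" using \<open>\<delta> > 0\<close> by (auto simp: d_def)
  have \<alpha>: "0 < \<alpha>" "\<alpha> < 1" using assms(8) by auto

  have E: "integral\<^sup>L M (X i) = \<mu> i" if "1 \<le> i" for i
    by (rule normal_distributed_expectation[OF _ assms(3)[OF that]]) simp
  have var: "covariance M (X i) (X i) = 1" if "1 \<le> i" for i
    using normal_distributed_variance[OF _ assms(3)[OF that]]
    by (simp add: covariance_def power2_eq_square)
  \<comment> \<open>Unit variances identify correlations with covariances, on the diagonal too, so
    positive semidefiniteness carries over to \<open>S\<close>.\<close>
  have S_cov: "S i j = covariance M (X i) (X j)" if "1 \<le> i" "1 \<le> j" for i j
    using that by (simp add: S_def correlation_def var)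
  have psd: "0 \<le> (\<Sum>i=1..n. \<Sum>j=1..n. b i * b j * S i j)" for b n
  proof -
    have "0 \<le> (\<Sum>i=1..n. \<Sum>j=1..n. b i * b j * covariance M (X i) (X j))"
    proof (rule covariance_psd)
      fix i assume "i \<in> {1..n}"
      then have D: "distributed M lborel (X i) (normal_density (\<mu> i) 1)" using assms(3) by simp
      show "X i \<in> borel_measurable M"
        using distributed_measurable[OF D] by simp
      show "integrable M (\<lambda>\<omega>. (X i \<omega> - integral\<^sup>L M (X i))\<^sup>2)"
        using normal_square_integrable[OF D] E \<open>i \<in> {1..n}\<close> by simp
    qed
    then show ?thesis by (simp add: S_cov)
  qed
  have gram: "(\<Sum>k=1..n. matrix_factor n S i k * matrix_factor n S j k) = S i j"
    if "i \<in> {1..n}" "j \<in> {1..n}" for i j n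
    by (rule matrix_factor_gram[OF _ psd that]) (auto simp: S_cov covariance_sym)

  have "eventually (\<lambda>N. \<delta> / 2 < Inf {\<rho> i j | i j. N \<le> i \<and> N \<le> j \<and> i \<noteq> j}) sequentially"
    using order_tendstoD(1)[OF assms(6), of "\<delta> / 2"] \<open>\<delta> > 0\<close> by simp
  then have "eventually (\<lambda>N. 1 \<le> N \<and> \<delta> / 2 < Inf {\<rho> i j | i j. N \<le> i \<and> N \<le> j \<and> i \<noteq> j}) sequentially"
    using eventually_ge_at_top[of 1] by eventually_elim auto
  then obtain N where N: "1 \<le> N" "\<delta> / 2 < Inf {\<rho> i j | i j. N \<le> i \<and> N \<le> j \<and> i \<noteq> j}"
    using eventually_happens[of _ sequentially] by auto
  have S_bounds: "S i j \<in> {d..1}" if "N \<le> i" "N \<le> j" for i j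
  proof (cases "i = j")
    case True
    then show ?thesis using d that N by (simp add: S_cov var)
  next
    case False
    \<comment> \<open>A lower bound is required for \<open>Inf\<close> on the reals to lie below
      each element; positivity of the correlations provides 0.\<close>
    have "bdd_below {\<rho> i j | i j. N \<le> i \<and> N \<le> j \<and> i \<noteq> j}"
      using assms(5) N(1) by (intro bdd_belowI[of _ 0]) (fastforce simp: less_imp_le)
    then have "Inf {\<rho> i j | i j. N \<le> i \<and> N \<le> j \<and> i \<noteq> j} \<le> \<rho> i j"
      using that False by (intro cInf_lower) auto
    then show ?thesis
      using N assms(4)[of i j] assms(5)[of i j] that False by (auto simp: S_def d_def)
  qed

  \<comment> \<open>The tail bound as a function of the threshold \<open>x\<close>: the first
    \<open>N - 1\<close> indices form a fixed set without a uniform correlation bound, and the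
    number of later ones is replaced by its bound in terms of \<open>x\<close>.\<close>
  define g where "g x = real (N - 1) * exp (- x\<^sup>2 / 2) + exp (- (d / 4 * x)\<^sup>2 / 2)
      + (\<alpha> * sqrt (2 * pi) * exp ((x + 1)\<^sup>2 / 2))
        * exp (- (x * (1 - d\<^sup>2 / 4))\<^sup>2 / (2 * (1 - d\<^sup>2)))" for x :: real
  have c_top: "filterlim c at_top sequentially"
    unfolding c_def[abs_def] by (rule filterlim_bonferroni_threshold[OF \<alpha>])
  have bound: "eventually (\<lambda>n. FWER n \<alpha> S \<le> g (c n)) sequentially"
    using eventually_ge_at_top[of N] filterlim_at_top_dense[THEN iffD1, OF c_top, rule_format, of 0]
  proof eventually_elim
    case (elim n)
    have un: "{1..n} = {1..<N} \<union> {N..n}" using elim N by auto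
    have "FWER n \<alpha> S \<le> real (card {1..<N}) * exp (- (c n)\<^sup>2 / 2) + exp (- (d / 4 * c n)\<^sup>2 / 2)
        + real (card {N..n}) * exp (- (c n * (1 - d\<^sup>2 / 4))\<^sup>2 / (2 * (1 - d\<^sup>2)))"
      unfolding FWER_eq_measure_factor c_def[symmetric]
      \<comment> \<open>The index set is split at \<open>N\<close>, so that {1..<N} plays the role
        of \<open>I\<close> and {N..n} that of \<open>J\<close>.\<close>
      unfolding bex_simps un[THEN arg_cong, of "\<lambda>A. Bex A P" for P]
    proof (rule max_correlated_normals_tail)
      show "(\<Sum>k=1..n. (matrix_factor n S i k)\<^sup>2) = 1" if "i \<in> {1..<N} \<union> {N..n}" for i
      proof -
        have i: "i \<in> {1..n}" using that un by blast
        show ?thesis using gram[OF i i] i by (simp add: power2_eq_square S_cov var)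
      qed
      show "(\<Sum>k=1..n. matrix_factor n S i k * matrix_factor n S j k) \<in> {d..1}"
        if "i \<in> {N..n}" "j \<in> {N..n}" for i j
        using gram[of i n j] S_bounds[of i j] that N by auto
    qed (use elim d in auto)
    also have "\<dots> \<le> g (c n)"
    proof -
      have "real (card {N..n}) \<le> real n" using N by simp
      also have "\<dots> \<le> \<alpha> * sqrt (2 * pi) * exp ((c n + 1)\<^sup>2 / 2)"
        using elim N by (intro bonferroni_threshold_growth[OF \<alpha>]) (auto simp: c_def)
      finally show ?thesis
        unfolding g_def by (intro add_mono mult_right_mono) auto
    qed
    finally show ?case .
  qed
  have lim: "(\<lambda>n. g (c n)) \<longlonglongrightarrow> 0"
    unfolding g_def by (rule filterlim_compose[OF bonferroni_bound_tendsto_0[OF d] c_top])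
  have "eventually (\<lambda>n. 0 \<le> FWER n \<alpha> S) sequentially"
    by (simp add: FWER_def)
  then have "(\<lambda>n. FWER n \<alpha> S) \<longlonglongrightarrow> 0"
    by (rule tendsto_sandwich[OF _ bound tendsto_const lim])
  then show ?thesis by (simp add: S_def[abs_def])
qed

end
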